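(* Let $n\ge1$ and $p\in(0,1)$, and let $G_s$ be the unique symmetric seller-worst information structure, i.e. the unique maximizer of $V_0(G,\dots,G)$ over CDFs $G$ on $[0,1]$ with mean $p$. Then the profile $(G_s,\dots,G_s)$ is the unique maximizer of $V_0(G_1,\dots,G_n)$ over all (possibly asymmetric) profiles $(G_1,\dots,G_n)$ of CDFs on $[0,1]$ with $\int_0^1(1-G_i(x))\,\mathrm dx=p$ for every $i=1,\dots,n$.
   Context: There are $n$ buyers, $N=\{1,\dots,n\}$, and one object. Each buyer's valuation is independently Bernoulli on $\{0,1\}$ with mean $p\in(0,1)$. An information structure is a profile $\mathbf G=(G_1,\dots,G_n)$ of (right-continuous) CDFs on $[0,1]$, each with mean $p$; buyer $i$ receives a signal $x_i\sim G_i$, independently across buyers. Ironed virtual value. For a CDF $G$ on $[0,1]$ let $a=\inf\{x\in[0,1]: G(x)>0\}$; $\Psi(x|G)=0$ for $x\in[0,a)$ and $\Psi(x|G)=a-x(1-G(x))$ for $x\in[a,1]$. Let $\Theta=\{(\beta_0,\beta_1)\in\mathbb R^2:\beta_0+\beta_1G(x)\le\Psi(x|G)\ \forall x\in[0,1]\}$ and $\Phi(x|G)=\sup\{\beta_0+\beta_1G(x):(\beta_0,\beta_1)\in\Theta\}$. A number $w$ is a sub-gradient of $\Phi(\cdot|G)$ at $x$ if $\Phi(z|G)-\Phi(x|G)\ge w\,(G(z)-G(x))$ for all $z\in[0,1]$. The ironed virtual value $\hat\varphi(x|G)$ is the infimum (possibly $-\infty$) of the set of sub-gradients at $x$. Allocation.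 For a signal profile $x$ let $M(x|\mathbf G)=\{i\in N:\hat\varphi(x_i|G_i)\ge\max_j\{\hat\varphi(x_j|G_j),0\}\}$ and $M'(x|\mathbf G)=\{i\in M(x|\mathbf G): x_i\ge x_j\ \forall j\in M(x|\mathbf G)\}$. Put $q_i(x|\mathbf G)=1/|M'(x|\mathbf G)|$ if $i\in M'(x|\mathbf G)$ and $0$ otherwise. Objective. For $\alpha\in\{0,1\}$, $$V_\alpha(\mathbf G)=\int_{[0,1]^n}\sum_{i=1}^n\big(\alpha x_i-\hat\varphi(x_i|G_i)\big)q_i(x|\mathbf G)\prod_{i=1}^n\mathrm dG_i(x_i)$$ (terms with $q_i=0$ are $0$); $-V_0(\mathbf G)$ is the seller's optimal-auction revenue. The unique symmetric seller-worst structure $G_s$ has the truncated Pareto form $G_s(x)=0$ on $[0,x_s)$, $G_s(x)=1-\frac{x_s-k_s}{x-k_s}$ on $[x_s,1)$, $G_s(1)=1$, for some $(k_s,x_s)\in[0,1]^2$ depending on $(p,n)$. *)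

theory Defs
  imports "HOL-Probability.Probability"
begin

text \<open>A CDF on $[0,1]$ is represented by its extension to the whole real line, constantly 0
  on the left and constantly 1 on the right, so that equality of CDFs is equality of functions.
  An atom at 0 is allowed.\<close>

definition cdf_on_unit :: "(real \<Rightarrow> real) \<Rightarrow> bool" where
  "cdf_on_unit G \<longleftrightarrow>
     mono G \<and> (\<forall>x. continuous (at_right x) G) \<and> (\<forall>x<0. G x = 0) \<and> (\<forall>x\<ge>1. G x = 1)"

definition cdfs_with_mean :: "real \<Rightarrow> (real \<Rightarrow> real) set" where
  "cdfs_with_mean p = {G. cdf_on_unit G \<and> (LBINT x:{0..1}. 1 - G x) = p}"

definition lowest_signal :: "(real \<Rightarrow> real) \<Rightarrow> real" where
  "lowest_signal G = Inf {x \<in> {0..1}. G x > 0}"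

definition Psi :: "(real \<Rightarrow> real) \<Rightarrow> real \<Rightarrow> real" where
  "Psi G x = (if x < lowest_signal G then 0 else lowest_signal G - x * (1 - G x))"

definition Theta :: "(real \<Rightarrow> real) \<Rightarrow> (real \<times> real) set" where
  "Theta G = {(b0, b1). \<forall>x\<in>{0..1}. b0 + b1 * G x \<le> Psi G x}"

definition Phi :: "(real \<Rightarrow> real) \<Rightarrow> real \<Rightarrow> real" where
  "Phi G x = (SUP (b0, b1) \<in> Theta G. b0 + b1 * G x)"

definition is_subgradient :: "(real \<Rightarrow> real) \<Rightarrow> real \<Rightarrow> real \<Rightarrow> bool" where
  "is_subgradient G x w \<longleftrightarrow> (\<forall>z\<in>{0..1}. Phi G z - Phi G x \<ge> w * (G z - G x))"

text \<open>The infimum is taken in the extended reals. At signals where $G$ attains its least value on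
  $[0,1]$, every number below a sub-gradient is again one, so the value is $-\infty$. For some $G$
  the slope of the hull at that least value is itself $-\infty$ and no sub-gradient exists (for
  instance $G(x) = c + x^2$ near 0 at the atom 0). The value there is $-\infty$ as well, whereas
  the infimum of the empty set in \<open>ereal\<close> would be $+\infty$.\<close>

definition ironed_virtual_value :: "(real \<Rightarrow> real) \<Rightarrow> real \<Rightarrow> ereal" where
  "ironed_virtual_value G x =
     (if \<exists>w. is_subgradient G x w then INF w \<in> {w. is_subgradient G x w}. ereal w else -\<infinity>)"

text \<open>The buyers are $1,\dots,n$. Profiles of CDFs and of signals are functions on \<open>nat\<close>
  of which only the values at buyers matter.\<close>

definition top_buyers :: "nat \<Rightarrow> (nat \<Rightarrow> real \<Rightarrow> real) \<Rightarrow> (nat \<Rightarrow> real) \<Rightarrow> nat set" where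
  "top_buyers n G x =
     {i \<in> {1..n}. ironed_virtual_value (G i) (x i)
        \<ge> Max (insert 0 ((\<lambda>j. ironed_virtual_value (G j) (x j)) ` {1..n}))}"

definition winners :: "nat \<Rightarrow> (nat \<Rightarrow> real \<Rightarrow> real) \<Rightarrow> (nat \<Rightarrow> real) \<Rightarrow> nat set" where
  "winners n G x = {i \<in> top_buyers n G x. \<forall>j \<in> top_buyers n G x. x i \<ge> x j}"

definition alloc :: "nat \<Rightarrow> (nat \<Rightarrow> real \<Rightarrow> real) \<Rightarrow> (nat \<Rightarrow> real) \<Rightarrow> nat \<Rightarrow> real" where
  "alloc n G x i = (if i \<in> winners n G x then 1 / real (card (winners n G x)) else 0)"

text \<open>\<open>real_of_ereal\<close> loses nothing below: for CDFs on $[0,1]$ the ironed virtual value never exceeds 1,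
  and it is nonnegative for a buyer with positive allocation. Losing buyers, whose virtual value may
  be $-\infty$, contribute 0.\<close>

definition objective :: "real \<Rightarrow> nat \<Rightarrow> (nat \<Rightarrow> real \<Rightarrow> real) \<Rightarrow> real" where
  "objective \<alpha> n G =
     (LINT x : (\<Pi>\<^sub>E i\<in>{1..n}. {0..1}) | (\<Pi>\<^sub>M i\<in>{1..n}. interval_measure (G i)).
        \<Sum>i\<in>{1..n}.
          if alloc n G x i = 0 then 0
          else (\<alpha> * x i - real_of_ereal (ironed_virtual_value (G i) (x i))) * alloc n G x i)"

definition unique_maximizer :: "('a \<Rightarrow> real) \<Rightarrow> 'a set \<Rightarrow> 'a \<Rightarrow> bool" where
  "unique_maximizer f S x \<longleftrightarrow>
     is_arg_max f (\<lambda>y. y \<in> S) x \<and> (\<forall>y. is_arg_max f (\<lambda>y. y \<in> S) y \<longrightarrow> y = x)"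

text \<open>Functions restricted to the set of buyers are extensional, so that uniqueness of a profile
  concerns its values at buyers only.\<close>

definition symmetric_profile :: "nat \<Rightarrow> (real \<Rightarrow> real) \<Rightarrow> nat \<Rightarrow> real \<Rightarrow> real" where
  "symmetric_profile n G = (\<lambda>i\<in>{1..n}. G)"

end

theory Submission
  imports Defs
begin

text \<open>The seller's revenue is the expectation of the maximum of the positive parts of the ironed
  virtual values. These are independent with values in $[0,1]$, so with $F_i$ the distribution
  function for buyer $i$, $V_0(\mathbf G) = \int_0^1 \prod_i F_i(t)\,\mathrm dt - 1$. By AM-GM,
  $\prod_i F_i \le \frac1n \sum_i F_i^n$, that is, $V_0(\mathbf G)$ is at most the mean of the values
  of the symmetric profiles $(G_i,\dots,G_i)$. None of these exceeds that of $(G_s,\dots,G_s)$, and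
  equality forces every $G_i$ to be a symmetric maximizer.\<close>

section \<open>The ironed virtual value\<close>

lemma cdf_on_unit_bounds:
  assumes "cdf_on_unit G"
  shows "0 \<le> G x" "G x \<le> 1"
proof -
  have m: "mono G" and 0: "\<And>x. x < 0 \<Longrightarrow> G x = 0" and 1: "\<And>x. x \<ge> 1 \<Longrightarrow> G x = 1"
    using assms by (auto simp: cdf_on_unit_def)
  show "0 \<le> G x"
    using monoD[OF m, of "min x (-1)" x] 0[of "min x (-1)"] by auto
  show "G x \<le> 1"
    using monoD[OF m, of x "max x 1"] 1[of "max x 1"] by auto
qed

lemma lowest_signal_bounds:
  assumes "cdf_on_unit G"
  shows "0 \<le> lowest_signal G" "lowest_signal G \<le> 1"
proof -
  have "1 \<in> {x \<in> {0..1}. G x > 0}"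
    using assms by (auto simp: cdf_on_unit_def)
  then show "0 \<le> lowest_signal G" "lowest_signal G \<le> 1"
    unfolding lowest_signal_def
    by (auto intro!: cInf_greatest cInf_lower bdd_belowI[of _ 0])
qed

lemma lowest_signal_le:
  assumes "x \<in> {0..1}" "G x > 0"
  shows "lowest_signal G \<le> x"
  unfolding lowest_signal_def using assms by (auto intro!: cInf_lower bdd_belowI[of _ 0])

text \<open>With \<open>a = lowest_signal G\<close>, this is the line of slope 1 in the quantile
  \<open>G x\<close> that takes the value \<open>a\<close> at quantile 1. Below \<open>a\<close> the
  quantile is 0 and the line sits at \<open>a - 1\<close>, which is at most 0; from \<open>a\<close>
  on, \<open>x\<close> being at most 1 keeps it under \<open>Psi\<close>. It makes
  \<open>Theta G\<close> nonempty, so that the supremum in \<open>Phi\<close> is meaningful, and it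
  is the source of the upper bound 1 on virtual values.\<close>

lemma slope_one_in_Theta:
  assumes G: "cdf_on_unit G"
  shows "(lowest_signal G - 1, 1) \<in> Theta G"
proof -
  have "lowest_signal G - 1 + 1 * G x \<le> Psi G x" if x: "x \<in> {0..1}" for x
  proof (cases "x < lowest_signal G")
    case True
    then have "G x = 0"
      using lowest_signal_le[OF x, of G] cdf_on_unit_bounds[OF G, of x] by linarith
    then show ?thesis
      using True lowest_signal_bounds[OF G] by (simp add: Psi_def)
  next
    case False
    moreover have "x * (1 - G x) \<le> 1 * (1 - G x)"
      using x cdf_on_unit_bounds[OF G, of x] by (intro mult_right_mono) auto
    ultimately show ?thesis
      by (simp add: Psi_def)
  qed
  then show ?thesis
    by (auto simp: Theta_def)
qed

section \<open>The hull \<open>Phi\<close> as a convex function of the quantile\<close>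

lemma Theta_le_Phi:
  assumes "(b0, b1) \<in> Theta G" "x \<in> {0..1}"
  shows "b0 + b1 * G x \<le> Phi G x"
proof -
  \<comment> \<open>A supremum of reals is an upper bound only for a set bounded above; here
    membership in \<open>Theta G\<close> itself supplies the bound \<open>Psi G x\<close>.\<close>
  have "bdd_above ((\<lambda>(b0, b1). b0 + b1 * G x) ` Theta G)"
    using assms(2) by (intro bdd_aboveI[of _ "Psi G x"]) (auto simp: Theta_def)
  then show ?thesis
    unfolding Phi_def using cSUP_upper[OF assms(1)] by fastforce
qed

lemma Phi_leI:
  assumes "cdf_on_unit G" "\<And>b0 b1. (b0, b1) \<in> Theta G \<Longrightarrow> b0 + b1 * G x \<le> c"
  shows "Phi G x \<le> c"
  unfolding Phi_def using slope_one_in_Theta[OF assms(1)] assms(2)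
  by (intro cSUP_least) auto

lemma Phi_le_lowest_signal:
  assumes "cdf_on_unit G" "x \<in> {0..1}" "G x = 1"
  shows "Phi G x \<le> lowest_signal G"
proof (rule Phi_leI[OF assms(1)])
  fix b0 b1 assume "(b0, b1) \<in> Theta G"
  then have "b0 + b1 * G x \<le> Psi G x"
    using assms(2) by (auto simp: Theta_def)
  also have "\<dots> = lowest_signal G"
    using lowest_signal_le[OF assms(2), of G] assms(3) by (simp add: Psi_def)
  finally show "b0 + b1 * G x \<le> lowest_signal G" .
qed

lemma Phi_ge_slope_one:
  assumes "cdf_on_unit G" "x \<in> {0..1}"
  shows "lowest_signal G - (1 - G x) \<le> Phi G x"
  using Theta_le_Phi[OF slope_one_in_Theta[OF assms(1)] assms(2)] by simp

lemma Phi_cong: "G x = G y \<Longrightarrow> Phi G x = Phi G y"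
  by (simp add: Phi_def)

text \<open>In the variable \<open>G\<close> the hull is a supremum of affine functions, hence
  convex; this is the resulting inequality between adjacent chord slopes. Each affine minorant is
  interpolated exactly between \<open>G x\<close> and \<open>G z\<close>, and its end values are
  bounded by \<open>Phi\<close>.\<close>

lemma Phi_convex:
  assumes G: "cdf_on_unit G" and xz: "x \<in> {0..1}" "z \<in> {0..1}" and less: "G x < G y" "G y < G z"
  shows "(Phi G y - Phi G x) / (G y - G x) \<le> (Phi G z - Phi G y) / (G z - G y)"
proof -
  have "Phi G y \<le> (Phi G x * (G z - G y) + Phi G z * (G y - G x)) / (G z - G x)"
  proof (rule Phi_leI[OF G])
    fix b0 b1 assume b: "(b0, b1) \<in> Theta G"
    have "(b0 + b1 * G y) * (G z - G x)
        = (b0 + b1 * G x) * (G z - G y) + (b0 + b1 * G z) * (G y - G x)"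
      by algebra
    also have "\<dots> \<le> Phi G x * (G z - G y) + Phi G z * (G y - G x)"
      using Theta_le_Phi[OF b] xz less by (intro add_mono mult_right_mono) auto
    finally show "b0 + b1 * G y \<le> (Phi G x * (G z - G y) + Phi G z * (G y - G x)) / (G z - G x)"
      using less by (simp add: pos_le_divide_eq)
  qed
  then have "Phi G y * (G z - G x) \<le> Phi G x * (G z - G y) + Phi G z * (G y - G x)"
    using less by (simp add: pos_le_divide_eq)
  then have "(Phi G y - Phi G x) * (G z - G y) \<le> (Phi G z - Phi G y) * (G y - G x)"
    by (simp add: algebra_simps)
  then show ?thesis
    using less by (simp add: pos_divide_le_eq pos_le_divide_eq)
qed

section \<open>Sub-gradients of the hull: the bound 1 and existence\<close>

lemma is_subgradient_one:
  assumes "cdf_on_unit G" "x \<in> {0..1}" "G x = 1"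
  shows "is_subgradient G x 1"
  unfolding is_subgradient_def
proof
  fix z :: real assume z: "z \<in> {0..1}"
  show "Phi G z - Phi G x \<ge> 1 * (G z - G x)"
    using Phi_le_lowest_signal[OF assms] Phi_ge_slope_one[OF assms(1) z] assms(3) by simp
qed

text \<open>The chord from \<open>x\<close> to the signal 1 has slope at most 1, because the
  slope-one line lies below \<open>Phi\<close> at \<open>x\<close> and is not exceeded by it at
  quantile 1. A sub-gradient at \<open>x\<close> is at most that chord slope.\<close>

lemma subgradient_le_one:
  assumes G: "cdf_on_unit G" and x: "x \<in> {0..1}" and "G x < 1" and w: "is_subgradient G x w"
  shows "w \<le> 1"
proof -
  have G1: "G 1 = 1" using G by (simp add: cdf_on_unit_def)
  have "w * (1 - G x) \<le> Phi G 1 - Phi G x"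
    using w[unfolded is_subgradient_def, rule_format, of 1] G1 by simp
  also have "\<dots> \<le> 1 * (1 - G x)"
    using Phi_le_lowest_signal[OF G, of 1] Phi_ge_slope_one[OF G x] G1 by simp
  finally show ?thesis
    using \<open>G x < 1\<close> by simp
qed

text \<open>Above the least quantile \<open>G 0\<close> there are chords to the left, and convexity
  separates left slopes from right slopes. At the least quantile itself the slope may be minus
  infinity, which is why the inequality \<open>G 0 < G x\<close> is strict.\<close>

lemma subgradient_exists:
  assumes G: "cdf_on_unit G" and x: "x \<in> {0..1}" and less: "G 0 < G x"
  shows "\<exists>w. is_subgradient G x w"
proof (cases "G x = 1")
  case True
  then show ?thesis using is_subgradient_one[OF G x] by blast
next
  case False
  then have Gx1: "G x < G 1" and G1: "G 1 = 1"
    using cdf_on_unit_bounds[OF G, of x] G by (auto simp: cdf_on_unit_def)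
  define L where "L = {z \<in> {0..1}. G z < G x}"
  \<comment> \<open>The left derivative of the hull in the quantile. The chord to the signal 1
    bounds the supremum, since \<open>G x < G 1\<close>.\<close>
  define w where "w = (SUP z\<in>L. (Phi G x - Phi G z) / (G x - G z))"
  have ne: "L \<noteq> {}" using less by (auto simp: L_def intro: exI[of _ 0])
  have "bdd_above ((\<lambda>z. (Phi G x - Phi G z) / (G x - G z)) ` L)"
    using Phi_convex[OF G _ _ _ Gx1]
    by (intro bdd_aboveI2[where M = "(Phi G 1 - Phi G x) / (G 1 - G x)"]) (simp add: L_def)
  then have left: "(Phi G x - Phi G z) / (G x - G z) \<le> w" if "z \<in> L" for z
    unfolding w_def using that by (intro cSUP_upper)
  have right: "w \<le> (Phi G z - Phi G x) / (G z - G x)" if "z \<in> {0..1}" "G x < G z" for z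
    unfolding w_def
  proof (rule cSUP_least[OF ne])
    fix y assume "y \<in> L"
    then show "(Phi G x - Phi G y) / (G x - G y) \<le> (Phi G z - Phi G x) / (G z - G x)"
      using that by (intro Phi_convex[OF G]) (simp_all add: L_def)
  qed
  have "is_subgradient G x w"
    unfolding is_subgradient_def
  proof
    fix z :: real assume z: "z \<in> {0..1}"
    consider "G z < G x" | "G z = G x" | "G z > G x" by linarith
    then show "Phi G z - Phi G x \<ge> w * (G z - G x)"
    proof cases
      case 1
      then show ?thesis using left[of z] z by (auto simp: L_def pos_divide_le_eq algebra_simps)
    next
      case 2
      then show ?thesis using Phi_cong[of G z x] by simp
    next
      case 3
      then show ?thesis using right[OF z] by (simp add: pos_le_divide_eq)
    qed
  qed
  then show ?thesis by blast
qed

section \<open>Upper bound and monotonicity of the ironed virtual value\<close>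

lemma ironed_virtual_value_cong:
  "G x = G y \<Longrightarrow> ironed_virtual_value G x = ironed_virtual_value G y"
  using Phi_cong[of G x y] by (simp add: ironed_virtual_value_def is_subgradient_def cong: if_cong)

lemma ironed_virtual_value_le:
  assumes "is_subgradient G x w"
  shows "ironed_virtual_value G x \<le> ereal w"
  using assms by (auto simp: ironed_virtual_value_def intro: INF_lower)

lemma ironed_virtual_value_le_one:
  assumes G: "cdf_on_unit G" and x: "x \<in> {0..1}"
  shows "ironed_virtual_value G x \<le> 1"
proof (cases "\<exists>w. is_subgradient G x w")
  case True
  then obtain w where w: "is_subgradient G x w" "w \<le> 1"
    using is_subgradient_one[OF G x] subgradient_le_one[OF G x] cdf_on_unit_bounds[OF G, of x]
    by (metis order_le_less)
  have "ironed_virtual_value G x \<le> ereal w"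
    by (rule ironed_virtual_value_le[OF w(1)])
  also have "\<dots> \<le> 1" using w(2) by simp
  finally show ?thesis .
qed (simp add: ironed_virtual_value_def)

text \<open>All quantile increments from the minimum are nonnegative, so any number below a
  sub-gradient is again a sub-gradient and the infimum has no finite lower bound. If there is no
  sub-gradient, the default in the definition gives the same value.\<close>

lemma ironed_virtual_value_least:
  assumes G: "cdf_on_unit G" and x: "G x = G 0"
  shows "ironed_virtual_value G x = -\<infinity>"
proof (cases "\<exists>w. is_subgradient G x w")
  case True
  then obtain w where w: "is_subgradient G x w" by blast
  have "ironed_virtual_value G x \<le> ereal B" for B
  proof -
    have "is_subgradient G x (min w B)"
      unfolding is_subgradient_def
    proof
      fix z :: real assume z: "z \<in> {0..1}"
      then have "G x \<le> G z"
        using G x by (auto simp: cdf_on_unit_def dest: monoD)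
      then have "min w B * (G z - G x) \<le> w * (G z - G x)"
        by (intro mult_right_mono) auto
      also have "\<dots> \<le> Phi G z - Phi G x"
        using w z by (simp add: is_subgradient_def)
      finally show "Phi G z - Phi G x \<ge> min w B * (G z - G x)" .
    qed
    then have "ironed_virtual_value G x \<le> ereal (min w B)"
      by (rule ironed_virtual_value_le)
    also have "\<dots> \<le> ereal B" by simp
    finally show ?thesis .
  qed
  then show ?thesis by (rule ereal_bot)
qed (simp add: ironed_virtual_value_def)

lemma ironed_virtual_value_mono:
  assumes G: "cdf_on_unit G" and x: "x \<in> {0..1}" and y: "y \<in> {0..1}" and "x \<le> y"
  shows "ironed_virtual_value G x \<le> ironed_virtual_value G y"
proof -
  have m: "mono G" using G by (simp add: cdf_on_unit_def)
  have "G 0 \<le> G x" "G x \<le> G y"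
    using monoD[OF m] x \<open>x \<le> y\<close> by auto
  then consider "G x = G 0" | "G x = G y" | "G 0 < G x" "G x < G y" by linarith
  then show ?thesis
  proof cases
    case 1
    then show ?thesis using ironed_virtual_value_least[OF G] by simp
  next
    case 2
    then show ?thesis using ironed_virtual_value_cong[of G x y] by simp
  next
    case 3
    \<comment> \<open>Summing the sub-gradient inequalities at \<open>x\<close> and at
      \<open>y\<close> yields \<open>v <= w\<close> for every sub-gradient \<open>w\<close> at
      \<open>y\<close>. One \<open>v\<close> at \<open>x\<close> therefore bounds the whole infimum
      at \<open>y\<close> from below.\<close>
    obtain v where v: "is_subgradient G x v" using subgradient_exists[OF G x] 3 by auto
    have ex: "\<exists>w. is_subgradient G y w" using subgradient_exists[OF G y] 3 by auto
    have "ironed_virtual_value G x \<le> ereal w" if w: "is_subgradient G y w" for w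
    proof -
      have "v * (G y - G x) \<le> Phi G y - Phi G x"
        using v y by (simp add: is_subgradient_def)
      also have "\<dots> \<le> w * (G y - G x)"
        using w[unfolded is_subgradient_def, rule_format, OF x] by (simp add: algebra_simps)
      finally have "v \<le> w" using 3 by simp
      then show ?thesis
        using ironed_virtual_value_le[OF v] by (meson ereal_less_eq(3) order_trans)
    qed
    then show ?thesis
      using ex unfolding ironed_virtual_value_def[of G y] by (simp add: le_INF_iff)
  qed
qed

text \<open>The maximum with 0 is taken in \<open>ereal\<close>, before the conversion, so that the
  value minus infinity becomes 0 and the conversion is faithful for signals in the unit
  interval.\<close>

definition positive_virtual_value :: "(real \<Rightarrow> real) \<Rightarrow> real \<Rightarrow> real" where
  "positive_virtual_value G x = real_of_ereal (max 0 (ironed_virtual_value G x))"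

lemma ereal_positive_virtual_value:
  assumes "cdf_on_unit G" "x \<in> {0..1}"
  shows "ereal (positive_virtual_value G x) = max 0 (ironed_virtual_value G x)"
proof -
  have "max 0 (ironed_virtual_value G x) \<le> 1"
    using ironed_virtual_value_le_one[OF assms] by simp
  then have "\<bar>max 0 (ironed_virtual_value G x)\<bar> \<noteq> \<infinity>"
    by (cases "ironed_virtual_value G x") (auto simp: max_def)
  then show ?thesis
    unfolding positive_virtual_value_def by (rule ereal_real')
qed

lemma positive_virtual_value_bounds:
  assumes "cdf_on_unit G" "x \<in> {0..1}"
  shows "0 \<le> positive_virtual_value G x" "positive_virtual_value G x \<le> 1"
proof -
  have "0 \<le> ereal (positive_virtual_value G x)" "ereal (positive_virtual_value G x) \<le> 1"
    using ironed_virtual_value_le_one[OF assms] unfolding ereal_positive_virtual_value[OF assms]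
    by auto
  then show "0 \<le> positive_virtual_value G x" "positive_virtual_value G x \<le> 1"
    by simp_all
qed

lemma positive_virtual_value_mono:
  assumes "cdf_on_unit G"
  shows "mono_on {0..1} (positive_virtual_value G)"
proof (rule mono_onI)
  fix x y :: real assume xy: "x \<in> {0..1}" "y \<in> {0..1}" "x \<le> y"
  have "ereal (positive_virtual_value G x) \<le> ereal (positive_virtual_value G y)"
    using ironed_virtual_value_mono[OF assms xy] 
    unfolding ereal_positive_virtual_value[OF assms xy(1)] ereal_positive_virtual_value[OF assms xy(2)]
    by (rule max.mono[OF order_refl])
  then show "positive_virtual_value G x \<le> positive_virtual_value G y" by simp
qed

section \<open>The objective as an integral of distribution functions\<close>

lemma real_distribution_cdf_on_unit:
  assumes "cdf_on_unit G"
  shows "real_distribution (interval_measure G)" "cdf (interval_measure G) = G"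
proof -
  have m: "G x \<le> G y" if "x \<le> y" for x y
    using assms that by (auto simp: cdf_on_unit_def dest: monoD)
  have c: "continuous (at_right x) G" for x
    using assms by (simp add: cdf_on_unit_def)
  have bot: "(G \<longlongrightarrow> 0) at_bot"
    using assms by (intro tendsto_eventually eventually_at_bot_linorderI[of "-1"])
      (simp add: cdf_on_unit_def)
  have top: "(G \<longlongrightarrow> 1) at_top"
    using assms by (intro tendsto_eventually eventually_at_top_linorderI[of 1])
      (simp add: cdf_on_unit_def)
  show "real_distribution (interval_measure G)"
    by (rule real_distribution_interval_measure[OF m c bot top])
  show "cdf (interval_measure G) = G"
    by (rule cdf_interval_measure[OF m c bot])
qed

text \<open>The mass strictly below 0 is the left limit of \<open>G\<close> at 0, which vanishes; an
  atom at 0 stays inside the closed interval.\<close>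

lemma measure_unit_interval:
  assumes G: "cdf_on_unit G"
  shows "measure (interval_measure G) {0..1} = 1"
proof -
  interpret real_distribution "interval_measure G"
    by (rule real_distribution_cdf_on_unit[OF G])
  have "(G \<longlongrightarrow> measure (interval_measure G) {..<0}) (at_left 0)"
    using cdf_at_left[of 0] real_distribution_cdf_on_unit(2)[OF G] by simp
  moreover have "(G \<longlongrightarrow> 0) (at_left 0)"
    using G by (intro tendsto_eventually)
      (auto simp: eventually_at_filter cdf_on_unit_def)
  ultimately have 0: "measure (interval_measure G) {..<0} = 0"
    by (intro tendsto_unique[of "at_left 0"]) auto
  have 1: "measure (interval_measure G) {..1} = 1"
    using real_distribution_cdf_on_unit(2)[OF G] G unfolding cdf_def
    by (metis cdf_on_unit_def order_refl)
  have "measure (interval_measure G) ({..1} - {..<0}) = 1"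
    by (subst finite_measure_Diff) (auto simp: 0 1)
  moreover have "{..1} - {..<0} = {0..1::real}" by auto
  ultimately show ?thesis by simp
qed

text \<open>The value 2 off the signal space exceeds every virtual value, so that such signals count for
  no threshold in $[0,1]$.\<close>

definition unit_value :: "(real \<Rightarrow> real) \<Rightarrow> real \<Rightarrow> real" where
  "unit_value G x = (if x \<in> {0..1} then positive_virtual_value G x else 2)"

text \<open>For \<open>t\<close> in the unit interval this is the distribution function F_i(t) of
  the positive part of buyer i's virtual value.\<close>

definition value_cdf :: "(real \<Rightarrow> real) \<Rightarrow> real \<Rightarrow> real" where
  "value_cdf G t = measure (interval_measure G) {x. unit_value G x \<le> t}"

lemma unit_value_measurable:
  assumes "cdf_on_unit G"
  shows "unit_value G \<in> borel_measurable borel"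
proof -
  have "(\<lambda>x. if x \<in> {0..1} then positive_virtual_value G x else 2) \<in> borel_measurable borel"
    by (subst measurable_restrict_space_iff[symmetric])
      (auto intro: borel_measurable_mono_on_fnc positive_virtual_value_mono[OF assms])
  then show ?thesis
    unfolding unit_value_def[abs_def] .
qed

text \<open>Every top buyer has the same virtual value \<open>m\<close>, the maximum of 0 and all
  virtual values. Breaking ties by signals and splitting the object equally thus leaves the total
  unchanged: the shares of the winners add up to one payment of \<open>m\<close>, and
  \<open>m\<close> is the maximum of the positive parts.\<close>

lemma payoff_eq_Max:
  assumes n: "n \<ge> 1" and G: "\<And>i. i \<in> {1..n} \<Longrightarrow> cdf_on_unit (G i)"
    and x: "\<And>i. i \<in> {1..n} \<Longrightarrow> x i \<in> {0..1}"
  shows "(\<Sum>i\<in>{1..n}.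
          if alloc n G x i = 0 then 0
          else (0 * x i - real_of_ereal (ironed_virtual_value (G i) (x i))) * alloc n G x i)
       = - Max ((\<lambda>i. positive_virtual_value (G i) (x i)) ` {1..n})"
proof -
  define v where "v i = ironed_virtual_value (G i) (x i)" for i
  define u where "u i = positive_virtual_value (G i) (x i)" for i
  define m where "m = Max (insert 0 (v ` {1..n}))"
  define r where "r = Max (u ` {1..n})"
  have u: "ereal (u i) = max 0 (v i)" if "i \<in> {1..n}" for i
    unfolding u_def v_def by (rule ereal_positive_virtual_value[OF G[OF that] x[OF that]])
  have vm: "v i \<le> m" if "i \<in> {1..n}" for i
    unfolding m_def using that by (intro Max_ge) auto
  have m0: "0 \<le> m"
    unfolding m_def by (intro Max_ge) auto
  have "m \<in> insert 0 (v ` {1..n})"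
    unfolding m_def by (intro Max_in) auto
  then consider "m = 0" | i where "i \<in> {1..n}" "m = v i" by auto
  then have "\<exists>i\<in>{1..n}. ereal (u i) = m"
  proof cases
    case 1
    \<comment> \<open>If the maximum is the inserted 0, no virtual value is positive, so the
      positive part of every buyer is 0; buyer 1 exists because \<open>n >= 1\<close>.\<close>
    then have "ereal (u 1) = m" using u[of 1] vm[of 1] n by (simp add: max_def)
    then show ?thesis using n by auto
  next
    case (2 i)
    then have "ereal (u i) = m" using u[of i] m0 by (simp add: max_def)
    then show ?thesis using 2 by auto
  qed
  then obtain k where k: "k \<in> {1..n}" "ereal (u k) = m" by auto
  have "u i \<le> u k" if "i \<in> {1..n}" for i
  proof -
    have "ereal (u i) \<le> ereal (u k)" using u[OF that] vm[OF that] m0 k by simp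
    then show ?thesis by simp
  qed
  then have "r = u k"
    unfolding r_def using k(1) by (intro Max_eqI) auto
  with k(2) have rm: "ereal r = m" by simp
  have top: "top_buyers n G x = {i \<in> {1..n}. v i = m}"
    unfolding top_buyers_def using vm by (auto simp: m_def v_def intro: antisym)
  define W where "W = winners n G x"
  have W: "W \<subseteq> top_buyers n G x"
    unfolding W_def winners_def by auto
  have fin: "finite (top_buyers n G x)" unfolding top by simp
  have finW: "finite W" using W fin by (rule finite_subset)
  have "(\<Sum>i\<in>{1..n}. if alloc n G x i = 0 then 0
          else (0 * x i - real_of_ereal (ironed_virtual_value (G i) (x i))) * alloc n G x i)
     = (\<Sum>i\<in>{1..n}. if i \<in> W then - r / card W else 0)"
  proof (rule sum.cong[OF refl])
    fix i assume "i \<in> {1..n}"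
    show "(if alloc n G x i = 0 then 0
          else (0 * x i - real_of_ereal (ironed_virtual_value (G i) (x i))) * alloc n G x i)
      = (if i \<in> W then - r / card W else 0)"
    proof (cases "i \<in> W")
      case True
      then have "v i = ereal r" using W top rm by auto
      moreover have "card W \<noteq> 0" using True finW by auto
      ultimately show ?thesis
        using True by (simp add: alloc_def W_def[symmetric] v_def)
    qed (simp add: alloc_def W_def[symmetric])
  qed
  also have "\<dots> = (\<Sum>i\<in>W. - r / card W)"
    using W top by (intro sum.mono_neutral_cong_right) auto
  also have "\<dots> = - r"
  \<comment> \<open>The object stays unsold only if \<open>m\<close> is the inserted 0, and then
    \<open>r = 0\<close> agrees with the empty sum. Otherwise a top buyer with the largest signal
    wins, so the division by \<open>card W\<close> is proper.\<close>
  proof (cases "top_buyers n G x = {}")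
    case True
    then have "m = 0" using \<open>m \<in> insert 0 (v ` {1..n})\<close> top by auto
    then have "r = 0" using rm by simp
    then show ?thesis by simp
  next
    case False
    define M where "M = Max (x ` top_buyers n G x)"
    have "M \<in> x ` top_buyers n G x"
      unfolding M_def using fin False by (intro Max_in) auto
    moreover have "x j \<le> M" if "j \<in> top_buyers n G x" for j
      unfolding M_def using fin that by (intro Max_ge) auto
    ultimately have "W \<noteq> {}"
      unfolding W_def winners_def by blast
    then have "card W \<noteq> 0" using finW by simp
    then show ?thesis by simp
  qed
  finally show ?thesis
    by (simp add: r_def u_def)
qed

lemma integral_threshold:
  fixes w :: real
  assumes "0 \<le> w"
  shows "(\<integral>t. indicator {0..1} t * indicator {w..} t \<partial>lborel) = max 0 (1 - w)"
proof -
  have "(\<lambda>t. indicator {0..1} t * indicator {w..} t) = (indicator {w..1} :: real \<Rightarrow> real)"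
    using assms by (auto simp: indicator_def)
  then show ?thesis by (simp add: max_def)
qed

text \<open>By \<open>payoff_eq_Max\<close> the objective is minus the expectation of the largest
  positive part \<open>W\<close>. Writing \<open>1 - W\<close> as the length of the set of
  thresholds \<open>t\<close> in the unit interval with \<open>W <= t\<close>, exchanging the
  integrals and using independence of the signals gives the product of the distribution
  functions.\<close>

lemma objective_zero_eq:
  assumes n: "n \<ge> 1" and cdf: "\<And>i. i \<in> {1..n} \<Longrightarrow> cdf_on_unit (G i)"
  shows "objective 0 n G = (\<integral>t. indicator {0..1} t * (\<Prod>i\<in>{1..n}. value_cdf (G i) t) \<partial>lborel) - 1"
proof -
  \<comment> \<open>Indices that are not buyers are redirected to buyer 1, so that every factor is a
    probability measure, as \<open>product_prob_space\<close> asks of all indices.\<close>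
  define \<mu> where "\<mu> i = interval_measure (G (if i \<in> {1..n} then i else 1))" for i
  have dist: "real_distribution (\<mu> i)" for i
    unfolding \<mu>_def using n by (intro real_distribution_cdf_on_unit cdf) auto
  have ps: "prob_space (\<mu> i)" for i
    using dist[of i] by (simp add: real_distribution_def)
  have sets_\<mu>[measurable_cong, simp]: "sets (\<mu> i) = sets borel" for i
    by (simp add: \<mu>_def)
  interpret P: product_prob_space \<mu> "{1..n}"
    by (intro product_prob_spaceI ps)
  interpret P: finite_product_prob_space \<mu> "{1..n}"
    by unfold_locales auto
  define M where "M = Pi\<^sub>M {1..n} \<mu>"
  have M: "prob_space M" unfolding M_def by (rule P.prob_space_axioms)
  interpret M: prob_space M by (rule M)
  have M_eq: "Pi\<^sub>M {1..n} (\<lambda>i. interval_measure (G i)) = M"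
    unfolding M_def \<mu>_def by (intro PiM_cong) auto
  have space_M: "space M = (\<Pi>\<^sub>E i\<in>{1..n}. UNIV)"
    unfolding M_def by (simp add: space_PiM \<mu>_def)
  have val[measurable]: "(\<lambda>x. unit_value (G i) (x i)) \<in> borel_measurable M" if "i \<in> {1..n}" for i
  proof -
    have "unit_value (G i) \<in> borel_measurable (\<mu> i)"
      using unit_value_measurable[OF cdf[OF that]] by (simp add: measurable_def \<mu>_def)
    then show ?thesis
      unfolding M_def by (rule measurable_compose[OF measurable_component_singleton[OF that]])
  qed
  define S where "S = (\<Pi>\<^sub>E i\<in>{1..n}. {0..1::real})"
  have S[measurable]: "S \<in> sets M"
    unfolding S_def M_def by (intro sets_PiM_I_finite) auto
  have "measure M S = (\<Prod>i\<in>{1..n}. measure (\<mu> i) {0..1})"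
    unfolding S_def M_def by (intro P.finite_measure_PiM_emb) auto
  also have "\<dots> = 1"
    by (intro prod.neutral) (auto simp: \<mu>_def intro!: measure_unit_interval cdf)
  finally have measure_S: "measure M S = 1" .

  \<comment> \<open>With \<open>unit_value\<close>, a profile having a signal outside the unit
    interval gets \<open>W >= 2\<close>, so it adds nothing to
    \<open>max 0 (1 - W x)\<close>.\<close>
  define W where "W x = Max ((\<lambda>i. unit_value (G i) (x i)) ` {1..n})" for x
  have W_meas[measurable]: "W \<in> borel_measurable M"
    unfolding W_def by measurable
  have W_le: "W x \<le> t \<longleftrightarrow> (\<forall>i\<in>{1..n}. unit_value (G i) (x i) \<le> t)" for x t
    unfolding W_def using n by (subst Max_le_iff) auto
  have unit_nonneg: "0 \<le> unit_value (G i) y" if "i \<in> {1..n}" for i y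
    using positive_virtual_value_bounds(1)[OF cdf[OF that], of y] by (simp add: unit_value_def)
  have W_nonneg: "0 \<le> W x" for x
  proof -
    have "unit_value (G 1) (x 1) \<le> W x" using W_le[of x "W x"] n by auto
    then show ?thesis using unit_nonneg[of 1 "x 1"] n by simp
  qed
  define h :: "(nat \<Rightarrow> real) \<Rightarrow> real \<Rightarrow> real"
    where "h x t = indicator {0..1} t * indicator {W x..} t" for x t
  interpret L: pair_sigma_finite M lborel
    by unfold_locales
  have "integrable (M \<Otimes>\<^sub>M lborel) (case_prod h)"
  proof (rule Bochner_Integration.integrable_bound)
    have *: "emeasure (M \<Otimes>\<^sub>M lborel) (space M \<times> {0..1::real}) = 1"
      by (subst lborel.emeasure_pair_measure_Times) (auto simp: M.emeasure_space_1)
    then show "integrable (M \<Otimes>\<^sub>M lborel) (indicator (space M \<times> {0..1::real}) :: _ \<Rightarrow> real)"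
      by (intro integrable_real_indicator pair_measureI) (simp_all add: *)
    have "case_prod h = (\<lambda>z. indicator {0..1} (snd z) * (if W (fst z) \<le> snd z then 1 else 0))"
      by (auto simp: h_def indicator_def fun_eq_iff)
    then show "case_prod h \<in> borel_measurable (M \<Otimes>\<^sub>M lborel)"
      by simp
    show "AE z in M \<Otimes>\<^sub>M lborel. norm (case_prod h z)
        \<le> norm (indicator (space M \<times> {0..1}) z :: real)"
      by (auto simp: h_def indicator_def space_pair_measure)
  qed
  then have Fubini: "(\<integral>t. (\<integral>x. h x t \<partial>M) \<partial>lborel) = (\<integral>x. (\<integral>t. h x t \<partial>lborel) \<partial>M)"
    by (rule L.Fubini_integral)
  have inner_t: "(\<integral>t. h x t \<partial>lborel) = max 0 (1 - W x)" for x
    unfolding h_def by (rule integral_threshold[OF W_nonneg])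
  have inner_x: "(\<integral>x. h x t \<partial>M) = indicator {0..1} t * (\<Prod>i\<in>{1..n}. value_cdf (G i) t)" for t
  proof -
    \<comment> \<open>The event \<open>W x <= t\<close> is the intersection of one event per buyer,
      so its indicator is a product of functions of single coordinates and its integral
      factors.\<close>
    have A: "{y. unit_value (G i) y \<le> t} \<in> sets (\<mu> i)" if "i \<in> {1..n}" for i
      using unit_value_measurable[OF cdf[OF that]] by simp
    have "indicator {W x..} t = (\<Prod>i\<in>{1..n}. indicator {y. unit_value (G i) y \<le> t} (x i) :: real)" for x
      using W_le[of x t] by (auto simp: indicator_def of_bool_def prod.neutral intro: prod_zero)
    then have "(\<integral>x. indicator {W x..} t \<partial>M)
      = (\<integral>x. (\<Prod>i\<in>{1..n}. indicator {y. unit_value (G i) y \<le> t} (x i) :: real) \<partial>M)"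
      by simp
    also have "\<dots> = (\<Prod>i\<in>{1..n}. \<integral>y. indicator {y. unit_value (G i) y \<le> t} y \<partial>\<mu> i)"
      unfolding M_def using A
      by (intro P.product_integral_prod integrable_real_indicator)
        (auto simp: less_top[symmetric])
    also have "\<dots> = (\<Prod>i\<in>{1..n}. value_cdf (G i) t)"
      using A by (intro prod.cong) (auto simp: value_cdf_def \<mu>_def)
    finally show ?thesis
      by (simp add: h_def)
  qed

  \<comment> \<open>On \<open>S\<close> the payoff is \<open>- W x\<close>, that is
    \<open>(1 - W x) - 1\<close>; off \<open>S\<close> both terms vanish. As \<open>S\<close> has
    measure 1, the indicator accounts for the constant \<open>- 1\<close> in the statement.\<close>
  have "objective 0 n G = (\<integral>x. max 0 (1 - W x) - indicator S x \<partial>M)"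
    unfolding objective_def M_eq set_lebesgue_integral_def S_def[symmetric]
  proof (rule Bochner_Integration.integral_cong[OF refl])
    fix x assume xM: "x \<in> space M"
    show "indicator S x *\<^sub>R (\<Sum>i\<in>{1..n}. if alloc n G x i = 0 then 0
          else (0 * x i - real_of_ereal (ironed_virtual_value (G i) (x i))) * alloc n G x i)
        = max 0 (1 - W x) - indicator S x"
    proof (cases "x \<in> S")
      case True
      then have x: "x i \<in> {0..1}" if "i \<in> {1..n}" for i
        using that unfolding S_def by (rule PiE_mem)
      have W: "W x = Max ((\<lambda>i. positive_virtual_value (G i) (x i)) ` {1..n})"
        unfolding W_def using x by (intro arg_cong[where f = Max] image_cong refl) (simp add: unit_value_def)
      have "W x \<le> 1"
        unfolding W_le using x positive_virtual_value_bounds(2)[OF cdf x] by (simp add: unit_value_def)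
      then show ?thesis
        using True payoff_eq_Max[of n G x, OF n cdf x] W by simp
    next
      case False
      then obtain i where i: "i \<in> {1..n}" "unit_value (G i) (x i) = 2"
        using xM unfolding S_def space_M PiE_iff unit_value_def by auto
      then have "2 \<le> W x"
        using W_le[of x "W x"] by (metis order_refl)
      then show ?thesis using False by simp
    qed
  qed
  also have "\<dots> = (\<integral>x. max 0 (1 - W x) \<partial>M) - measure M S"
  proof (subst Bochner_Integration.integral_diff)
    show "integrable M (\<lambda>x. max 0 (1 - W x))"
      by (rule M.integrable_const_bound[where B = 1]) (use W_nonneg in auto)
    show "integrable M (indicator S :: _ \<Rightarrow> real)"
      by (simp add: less_top[symmetric])
  qed (use S in simp)
  also have "(\<integral>x. max 0 (1 - W x) \<partial>M)
      = (\<integral>t. indicator {0..1} t * (\<Prod>i\<in>{1..n}. value_cdf (G i) t) \<partial>lborel)"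
    using Fubini by (simp add: inner_t inner_x)
  finally show ?thesis
    by (simp add: measure_S)
qed

section \<open>Comparison with symmetric profiles\<close>

lemma value_cdf_mono:
  assumes "cdf_on_unit G"
  shows "mono (value_cdf G)"
proof (rule monoI)
  interpret real_distribution "interval_measure G"
    by (rule real_distribution_cdf_on_unit[OF assms])
  fix s t :: real assume "s \<le> t"
  then show "value_cdf G s \<le> value_cdf G t"
    unfolding value_cdf_def using unit_value_measurable[OF assms]
    by (intro finite_measure_mono) auto
qed

lemma value_cdf_bounds:
  assumes "cdf_on_unit G"
  shows "0 \<le> value_cdf G t" "value_cdf G t \<le> 1"
proof -
  interpret real_distribution "interval_measure G"
    by (rule real_distribution_cdf_on_unit[OF assms])
  show "0 \<le> value_cdf G t" "value_cdf G t \<le> 1"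
    unfolding value_cdf_def by simp_all
qed

lemma value_cdf_prod_integrable:
  assumes cdf: "\<And>i. i \<in> I \<Longrightarrow> cdf_on_unit (G i)"
  shows "integrable lborel (\<lambda>t. indicator {0..1} t * (\<Prod>i\<in>I. value_cdf (G i) t))"
proof (rule Bochner_Integration.integrable_bound)
  show "integrable lborel (indicator {0..1} :: real \<Rightarrow> real)"
    by simp
  have "value_cdf (G i) \<in> borel_measurable borel" if "i \<in> I" for i
    by (intro borel_measurable_mono value_cdf_mono cdf that)
  then show "(\<lambda>t. indicator {0..1} t * (\<Prod>i\<in>I. value_cdf (G i) t)) \<in> borel_measurable lborel"
    by (intro borel_measurable_times borel_measurable_prod) auto
  have "0 \<le> (\<Prod>i\<in>I. value_cdf (G i) t)" "(\<Prod>i\<in>I. value_cdf (G i) t) \<le> 1" for t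
    using value_cdf_bounds[OF cdf] by (auto intro: prod_nonneg prod_le_1)
  then show "AE t in lborel. norm (indicator {0..1} t * (\<Prod>i\<in>I. value_cdf (G i) t))
      \<le> norm (indicator {0..1} t :: real)"
    by (auto simp: indicator_def)
qed

text \<open>AM-GM for the powers \<open>a i ^ card I\<close>, whose geometric mean is the product of
  the \<open>a i\<close>.\<close>

lemma prod_le_mean_power:
  fixes a :: "'a \<Rightarrow> real"
  assumes "finite I" "I \<noteq> {}" "\<And>i. i \<in> I \<Longrightarrow> 0 \<le> a i"
  shows "(\<Prod>i\<in>I. a i) \<le> (\<Sum>i\<in>I. a i ^ card I) / card I"
proof -
  have c: "card I \<noteq> 0" using assms by simp
  have p: "0 \<le> (\<Prod>i\<in>I. a i)" using assms by (intro prod_nonneg) auto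
  have "(\<Prod>i\<in>I. a i) = (\<Prod>i\<in>I. a i ^ card I) powr (1 / card I)"
  \<comment> \<open>Rewriting a natural power as \<open>powr\<close> requires a positive base, so a
    vanishing product is treated separately.\<close>
  proof (cases "(\<Prod>i\<in>I. a i) = 0")
    case False
    then show ?thesis
      using p c by (simp add: prod_power_distrib[symmetric] powr_realpow[symmetric] powr_powr)
  qed (use c in \<open>simp add: prod_power_distrib[symmetric]\<close>)
  also have "\<dots> \<le> (\<Sum>i\<in>I. a i ^ card I / card I)"
    using assms by (intro arith_geom_mean) auto
  finally show ?thesis by (simp add: sum_divide_distrib)
qed

text \<open>AM-GM is applied at each threshold \<open>t\<close> and then integrated. The power
  \<open>value_cdf (G i) t ^ n\<close> is the integrand for the symmetric profile built from
  \<open>G i\<close>, so the right-hand side is again made of objectives.\<close>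

lemma objective_zero_le_mean:
  assumes n: "n \<ge> 1" and cdf: "\<And>i. i \<in> {1..n} \<Longrightarrow> cdf_on_unit (G i)"
  shows "objective 0 n G \<le> (\<Sum>i\<in>{1..n}. objective 0 n (symmetric_profile n (G i))) / n"
proof -
  define P where "P t = indicator {0..1} t * (\<Prod>i\<in>{1..n}. value_cdf (G i) t)" for t :: real
  define Q where "Q i t = indicator {0..1} t * value_cdf (G i) t ^ n" for i and t :: real
  have P: "integrable lborel P" "objective 0 n G = integral\<^sup>L lborel P - 1"
    unfolding P_def[abs_def]
    by (intro value_cdf_prod_integrable cdf objective_zero_eq n; assumption)+
  have Q: "integrable lborel (Q i)"
      "objective 0 n (symmetric_profile n (G i)) = integral\<^sup>L lborel (Q i) - 1"
    if i: "i \<in> {1..n}" for i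
  proof -
    have eq: "Q i = (\<lambda>t. indicator {0..1} t
        * (\<Prod>j\<in>{1..n}. value_cdf (symmetric_profile n (G i) j) t))"
      unfolding Q_def[abs_def] by (simp add: symmetric_profile_def)
    have cdf': "cdf_on_unit (symmetric_profile n (G i) j)" if "j \<in> {1..n}" for j
      using cdf[OF i] that by (simp add: symmetric_profile_def)
    show "integrable lborel (Q i)"
      unfolding eq by (rule value_cdf_prod_integrable[OF cdf'])
    show "objective 0 n (symmetric_profile n (G i)) = integral\<^sup>L lborel (Q i) - 1"
      unfolding eq by (rule objective_zero_eq[OF n cdf'])
  qed
  have "P t \<le> (\<Sum>i\<in>{1..n}. Q i t) / n" for t
  proof -
    have "(\<Prod>i\<in>{1..n}. value_cdf (G i) t) \<le> (\<Sum>i\<in>{1..n}. value_cdf (G i) t ^ n) / n"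
      using prod_le_mean_power[of "{1..n}" "\<lambda>i. value_cdf (G i) t"] value_cdf_bounds(1)[OF cdf] n
      by simp
    then have "P t \<le> indicator {0..1} t * ((\<Sum>i\<in>{1..n}. value_cdf (G i) t ^ n) / n)"
      unfolding P_def by (intro mult_left_mono) auto
    also have "\<dots> = (\<Sum>i\<in>{1..n}. Q i t) / n"
      by (simp add: Q_def sum_distrib_left)
    finally show ?thesis .
  qed
  then have "integral\<^sup>L lborel P \<le> (\<integral>t. (\<Sum>i\<in>{1..n}. Q i t) / n \<partial>lborel)"
    using P(1) Q(1) by (intro integral_mono integrable_divide Bochner_Integration.integrable_sum) auto
  also have "\<dots> = (\<Sum>i\<in>{1..n}. integral\<^sup>L lborel (Q i)) / n"
    using Q(1) by (simp add: Bochner_Integration.integral_sum)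
  \<comment> \<open>Each symmetric integral exceeds its objective by 1; the average of these
    \<open>n\<close> ones cancels the \<open>- 1\<close> on the left.\<close>
  also have "\<dots> = (\<Sum>i\<in>{1..n}. objective 0 n (symmetric_profile n (G i)) + 1) / n"
    using Q(2) by simp
  also have "\<dots> = (\<Sum>i\<in>{1..n}. objective 0 n (symmetric_profile n (G i))) / n + 1"
    using n by (simp add: sum.distrib add_divide_distrib)
  finally show ?thesis using P(2) by simp
qed

theorem theorem3:
  fixes n :: nat and p :: real and G\<^sub>s :: "real \<Rightarrow> real"
  assumes "n \<ge> 1" and "0 < p" and "p < 1"
    and "unique_maximizer (\<lambda>G. objective 0 n (symmetric_profile n G)) (cdfs_with_mean p) G\<^sub>s"
  shows "unique_maximizer (objective 0 n) (\<Pi>\<^sub>E i\<in>{1..n}. cdfs_with_mean p) (symmetric_profile n G\<^sub>s)"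
proof -
  define V where "V G = objective 0 n (symmetric_profile n G)" for G
  have Gs: "G\<^sub>s \<in> cdfs_with_mean p" and max: "\<And>G. G \<in> cdfs_with_mean p \<Longrightarrow> V G \<le> V G\<^sub>s"
    and unique: "\<And>G. G \<in> cdfs_with_mean p \<Longrightarrow> V G = V G\<^sub>s \<Longrightarrow> G = G\<^sub>s"
    using assms(4) by (auto simp: unique_maximizer_def is_arg_max_def not_less V_def)
  have mean: "objective 0 n G \<le> (\<Sum>i\<in>{1..n}. V (G i)) / n"
    if "G \<in> (\<Pi>\<^sub>E i\<in>{1..n}. cdfs_with_mean p)" for G
    unfolding V_def using that assms(1)
    by (intro objective_zero_le_mean) (auto simp: cdfs_with_mean_def PiE_iff)
  have bound: "(\<Sum>i\<in>{1..n}. V (G i)) \<le> n * V G\<^sub>s"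
    if "G \<in> (\<Pi>\<^sub>E i\<in>{1..n}. cdfs_with_mean p)" for G
    using sum_bounded_above[of "{1..n}" "\<lambda>i. V (G i)" "V G\<^sub>s"] that max by (auto simp: PiE_iff)
  have le: "objective 0 n G \<le> V G\<^sub>s" if "G \<in> (\<Pi>\<^sub>E i\<in>{1..n}. cdfs_with_mean p)" for G
  proof -
    have "n * objective 0 n G \<le> (\<Sum>i\<in>{1..n}. V (G i))"
      using mean[OF that] assms(1) by (simp add: pos_le_divide_eq mult.commute)
    also have "\<dots> \<le> n * V G\<^sub>s"
      by (rule bound[OF that])
    finally show ?thesis using assms(1) by simp
  qed
  have sym: "symmetric_profile n G\<^sub>s \<in> (\<Pi>\<^sub>E i\<in>{1..n}. cdfs_with_mean p)"
    using Gs by (simp add: symmetric_profile_def)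
  \<comment> \<open>Any maximizer satisfies this inequality, since the symmetric profile is feasible
    and attains the value \<open>V G\<^sub>s\<close>.\<close>
  have "G = symmetric_profile n G\<^sub>s"
    if G: "G \<in> (\<Pi>\<^sub>E i\<in>{1..n}. cdfs_with_mean p)" and ge: "V G\<^sub>s \<le> objective 0 n G" for G
  proof -
    have Gi: "G i \<in> cdfs_with_mean p" if "i \<in> {1..n}" for i
      using G that by (rule PiE_mem)
    have "n * V G\<^sub>s \<le> n * objective 0 n G"
      using ge by (intro mult_left_mono) auto
    also have "\<dots> \<le> (\<Sum>i\<in>{1..n}. V (G i))"
      using mean[OF G] assms(1) by (simp add: pos_le_divide_eq mult.commute)
    \<comment> \<open>The chain runs against \<open>bound\<close>, so the sum of the gaps is zero.
      Each gap is nonnegative by maximality of \<open>G\<^sub>s\<close>, hence each of them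
      vanishes.\<close>
    finally have "(\<Sum>i\<in>{1..n}. V G\<^sub>s - V (G i)) = 0"
      using bound[OF G] by (simp add: sum_subtractf)
    then have "V (G i) = V G\<^sub>s" if "i \<in> {1..n}" for i
      using sum_nonneg_0[of "{1..n}" "\<lambda>i. V G\<^sub>s - V (G i)" i] max[OF Gi] that by simp
    then have "G i = G\<^sub>s" if "i \<in> {1..n}" for i
      using unique[OF Gi[OF that]] that by simp
    \<comment> \<open>Both profiles are extensional, so agreement at the buyers is equality of
      functions.\<close>
    then show ?thesis
      using G by (auto simp: symmetric_profile_def fun_eq_iff PiE_iff extensional_def)
  qed
  then show ?thesis
    using le sym unfolding unique_maximizer_def is_arg_max_def
    by (metis V_def leD leI)
qed

end
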